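(* Let $\mathscr{M}$ be a statistical model, $\Psi:\mathscr{M}\to\mathbb{R}$ a pathwise differentiable parameter with efficient influence function $\phi_Q$ at each $Q\in\mathscr{M}$, let $P\in\mathscr{M}$ and $x\in\mathscr{X}(P)$. Let $H_{x,\lambda}$ with support $\mathscr{S}_{x,\lambda}$, $P_{\epsilon,\lambda}=(1-\epsilon)P+\epsilon H_{x,\lambda}$, the Kullback--Leibler projection $P^*_{\epsilon,\lambda}$ of $P_{\epsilon,\lambda}$, $\phi^*_{\epsilon,\lambda}=\phi_{P^*_{\epsilon,\lambda}}$ and $r(\lambda)=\|dH_{x,\lambda}/dP\|_{2,P}$ be as defined in the context, and suppose that $P^*_{\epsilon,\lambda}$ exists and is in $\mathscr{M}$ for all sufficiently small $\epsilon$ and $\lambda$. Suppose that $$\lim_{\lambda\to0}\int\phi_P(u)\,dH_{x,\lambda}(u)=\phi_P(x)\quad\text{and}\quad\lim_{\lambda\to0}\lim_{\epsilon\to0}\int\phi^*_{\epsilon,\lambda}(u)\,dP(u)=0.$$ Then $$\lim_{\lambda\to0}\lim_{\epsilon\to0}\int\phi^*_{\epsilon,\lambda}(u)\,d(H_{x,\lambda}-P)(u)=\phi_P(x)$$ provided either (a) $\lim_{\lambda\to0}\lim_{\epsilon\to0}\|\phi^*_{\epsilon,\lambda}-\phi_P\|_{\infty,\mathscr{S}_{x,\lambda}}=0$, or (b) $\lim_{\lambda\to0}\lim_{\epsilon\to0}r(\lambda)\,\|\phi^*_{\epsilon,\lambda}-\phi_P\|_{2,P}=0$.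
   Context: Model and parameter. $\mathscr{M}$ is a collection of probability distributions on $\mathbb{R}^d$; $\mathscr{X}(P)\subseteq\mathbb{R}^d$ is the sample space associated with $P\in\mathscr{M}$. $L_2^0(P)$ is the Hilbert space of real-valued functions on $\mathscr{X}(P)$ with mean zero and finite variance under $P$. The parameter $\Psi:\mathscr{M}\to\mathbb{R}$ is pathwise differentiable at $P$ if there is $\chi_P\in L_2^0(P)$ such that, for each regular one-dimensional parametric submodel $\{P_\epsilon:\epsilon\in\mathscr{E}\}\subseteq\mathscr{M}$, with $\mathscr{E}\subset\mathbb{R}$ an interval containing zero and $P_{\epsilon=0}=P$, one has $\frac{d}{d\epsilon}\Psi(P_\epsilon)|_{\epsilon=0}=\int\chi_P(u)s(u)\,dP(u)$, where $s$ is the score for $\epsilon$ at $\epsilon=0$ in the submodel; any such $\chi_P$ is called a gradient of $\Psi$ at $P$ relative to $\mathscr{M}$. The tangent space $T_{\mathscr{M}}(P)$ is the closure in $L_2^0(P)$ of the linear span of scores at $P$ arising from regular one-dimensional parametric submodels of $\mathscr{M}$ through $P$. The efficient influence function (EIF) $\phi_P$ is the unique gradient contained in $T_{\mathscr{M}}(P)$ (the canonical gradient). $\Psi$ is assumed pathwise differentiable, so that $\phi_Q$ is defined for $Q\in\mathscr{M}$. Perturbation and projection. For $\lambda>0$, $H_{x,\lambda}$ is a probability distribution symmetric about $x$, dominated by $P$, and such that $\int g(u)\,dH_{x,\lambda}(u)\to g(x)$ as $\lambda\to0$ for all $g$ in a sufficiently large class of functions; $\mathscr{S}_{x,\lambda}$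 is its support. For $0\le\epsilon\le1$, $P_{\epsilon,\lambda}:=(1-\epsilon)P+\epsilon H_{x,\lambda}$. Let $\mathscr{M}(P):=\{P_1\in\mathscr{M}:P_1\ll P\}$ and let $\nu$ be a measure dominating $P$. The projection is $$P^*_{\epsilon,\lambda}:=\operatorname{argmax}_{P_1\in\mathscr{M}(P)}\int\log\left\{\frac{dP_1}{d\nu}(u)\right\}dP_{\epsilon,\lambda}(u).$$ Write $\phi^*_{\epsilon,\lambda}:=\phi_{P^*_{\epsilon,\lambda}}$. Norms. $\|h\|_{2,P}:=\sqrt{\int h(u)^2\,dP(u)}$, $\|h\|_{\infty,A}:=\sup_{u\in A}|h(u)|$ for a set $A$, and $r(\lambda):=\|dH_{x,\lambda}/dP\|_{2,P}$. Conventions. $\epsilon\downarrow0$ and $\lambda\downarrow0$. A statement $\lim_{\lambda\to0}\lim_{\epsilon\to0}f(\epsilon,\lambda)=L$ is understood as: $f(\epsilon,\lambda)$ is arbitrarily close to $L$ for all small $\lambda$ and all sufficiently smaller $\epsilon$ (how small depending on $\lambda$), i.e. $\lim_{\lambda\to0}\limsup_{\epsilon\to0}|f(\epsilon,\lambda)-L|=0$. All integrals appearing are understood to be well defined. *)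

theory Defs
  imports "HOL-Probability.Probability"
begin

section \<open>Models, scores and efficient influence functions\<close>

type_synonym 'd distribution = "(real ^ 'd) measure"

text \<open>Distributions are Borel probability measures on the whole space; the sample space
  \<open>\<X> Q\<close> is a Borel set of full measure. Functions on \<open>\<X> Q\<close> are represented by total
  functions, so their values outside \<open>\<X> Q\<close> are irrelevant under \<open>Q\<close>.\<close>

definition statistical_model ::
    "('d::finite) distribution set \<Rightarrow> ('d distribution \<Rightarrow> (real ^ 'd) set) \<Rightarrow> bool" where
  "statistical_model \<M> \<X> \<longleftrightarrow>
     (\<forall>Q\<in>\<M>. prob_space Q \<and> sets Q = sets borel \<and> \<X> Q \<in> sets borel \<and> emeasure Q (\<X> Q) = 1)"

definition L2_zero :: "'a measure \<Rightarrow> ('a \<Rightarrow> real) set" where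
  "L2_zero P = {f. integrable P f \<and> integrable P (\<lambda>u. (f u)\<^sup>2) \<and> (\<integral>u. f u \<partial>P) = 0}"

text \<open>The norms take the value \<open>\<infinity>\<close> when the integral or the supremum is infinite.\<close>

definition L2_norm :: "'a measure \<Rightarrow> ('a \<Rightarrow> real) \<Rightarrow> ennreal" where
  "L2_norm P h = (let I = (\<integral>\<^sup>+u. ennreal ((h u)\<^sup>2) \<partial>P)
     in if I = \<infinity> then \<infinity> else ennreal (sqrt (enn2real I)))"

definition sup_norm :: "'a set \<Rightarrow> ('a \<Rightarrow> real) \<Rightarrow> ennreal" where
  "sup_norm A h = (SUP u\<in>A. ennreal \<bar>h u\<bar>)"

definition real_density :: "'a measure \<Rightarrow> 'a measure \<Rightarrow> 'a \<Rightarrow> real" where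
  "real_density \<mu> Q u = enn2real (RN_deriv \<mu> Q u)"

text \<open>\<open>regular_submodel \<M> P \<E> p s\<close>: the path \<open>\<epsilon> \<mapsto> p \<epsilon>\<close>, \<open>\<epsilon> \<in> \<E>\<close>, is a regular one-dimensional
  parametric submodel of \<open>\<M>\<close> through \<open>P\<close> with score \<open>s\<close> at \<open>\<epsilon> = 0\<close>. Regularity is
  differentiability in quadratic mean at \<open>0\<close> of a dominated family. The interval may have
  \<open>0\<close> as an endpoint, in which case derivatives at \<open>0\<close> are one-sided; it must not be \<open>{0}\<close>,
  for which they would be arbitrary.\<close>

definition regular_submodel ::
    "('d::finite) distribution set \<Rightarrow> 'd distribution \<Rightarrow> real set \<Rightarrow>
     (real \<Rightarrow> 'd distribution) \<Rightarrow> (real ^ 'd \<Rightarrow> real) \<Rightarrow> bool" where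
  "regular_submodel \<M> P \<E> p s \<longleftrightarrow>
     is_interval \<E> \<and> 0 \<in> \<E> \<and> \<E> \<noteq> {0} \<and>
     p 0 = P \<and> (\<forall>\<epsilon>\<in>\<E>. p \<epsilon> \<in> \<M>) \<and> s \<in> L2_zero P \<and>
     (\<exists>\<mu>. sigma_finite_measure \<mu> \<and> sets \<mu> = sets borel \<and>
        (\<forall>\<epsilon>\<in>\<E>. absolutely_continuous \<mu> (p \<epsilon>)) \<and>
        ((\<lambda>\<epsilon>. L2_norm \<mu> (\<lambda>u.
            (sqrt (real_density \<mu> (p \<epsilon>) u) - sqrt (real_density \<mu> P u)) / \<epsilon>
              - 1/2 * s u * sqrt (real_density \<mu> P u)))
          \<longlongrightarrow> 0) (at 0 within \<E>))"

definition scores ::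
    "('d::finite) distribution set \<Rightarrow> 'd distribution \<Rightarrow> (real ^ 'd \<Rightarrow> real) set" where
  "scores \<M> P = {s. \<exists>\<E> p. regular_submodel \<M> P \<E> p s}"

definition fun_span :: "('a \<Rightarrow> real) set \<Rightarrow> ('a \<Rightarrow> real) set" where
  "fun_span S = {g. \<exists>F c. finite F \<and> F \<subseteq> S \<and> g = (\<lambda>u. \<Sum>s\<in>F. c s * s u)}"

definition tangent_space ::
    "('d::finite) distribution set \<Rightarrow> 'd distribution \<Rightarrow> (real ^ 'd \<Rightarrow> real) set" where
  "tangent_space \<M> P =
     {h \<in> L2_zero P. \<forall>\<delta>>0. \<exists>g\<in>fun_span (scores \<M> P). L2_norm P (\<lambda>u. h u - g u) < \<delta>}"

definition is_gradient ::
    "('d::finite) distribution set \<Rightarrow> ('d distribution \<Rightarrow> real) \<Rightarrow> 'd distribution \<Rightarrow>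
     (real ^ 'd \<Rightarrow> real) \<Rightarrow> bool" where
  "is_gradient \<M> \<Psi> P D \<longleftrightarrow> D \<in> L2_zero P \<and>
     (\<forall>\<E> p s. regular_submodel \<M> P \<E> p s \<longrightarrow>
        ((\<lambda>\<epsilon>. \<Psi> (p \<epsilon>)) has_real_derivative (\<integral>u. D u * s u \<partial>P)) (at 0 within \<E>))"

definition pathwise_differentiable ::
    "('d::finite) distribution set \<Rightarrow> ('d distribution \<Rightarrow> real) \<Rightarrow> 'd distribution \<Rightarrow> bool" where
  "pathwise_differentiable \<M> \<Psi> P \<longleftrightarrow> (\<exists>D. is_gradient \<M> \<Psi> P D)"

text \<open>The efficient influence function is unique only up to \<open>P\<close>-null sets; the predicate
  holds of each of its versions.\<close>

definition is_EIF ::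
    "('d::finite) distribution set \<Rightarrow> ('d distribution \<Rightarrow> real) \<Rightarrow> 'd distribution \<Rightarrow>
     (real ^ 'd \<Rightarrow> real) \<Rightarrow> bool" where
  "is_EIF \<M> \<Psi> P \<phi> \<longleftrightarrow> is_gradient \<M> \<Psi> P \<phi> \<and> \<phi> \<in> tangent_space \<M> P"

section \<open>Perturbation and projection\<close>

definition symmetric_about :: "('a::euclidean_space) measure \<Rightarrow> 'a \<Rightarrow> bool" where
  "symmetric_about H x \<longleftrightarrow> distr H borel (\<lambda>u. 2 *\<^sub>R x - u) = H"

text \<open>A family indexed by \<open>lam > 0\<close>. The "sufficiently large class" of functions on which it
  acts as an approximate identity at \<open>x\<close> is left unspecified in the source, hence is the
  parameter \<open>\<G>\<close>; statements quantified over all \<open>\<G>\<close> cover every choice of it.\<close>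

definition smoothing_family ::
    "(('d::finite) distribution) \<Rightarrow> real ^ 'd \<Rightarrow> (real ^ 'd \<Rightarrow> real) set \<Rightarrow>
     (real \<Rightarrow> 'd distribution) \<Rightarrow> bool" where
  "smoothing_family P x \<G> H \<longleftrightarrow>
     (\<forall>lam>0. prob_space (H lam) \<and> sets (H lam) = sets borel \<and>
        symmetric_about (H lam) x \<and> absolutely_continuous P (H lam)) \<and>
     (\<forall>g\<in>\<G>. (\<forall>\<^sub>F lam in at_right 0. integrable (H lam) g) \<and>
        ((\<lambda>lam. \<integral>u. g u \<partial>(H lam)) \<longlongrightarrow> g x) (at_right 0))"

definition measure_support :: "('a::topological_space) measure \<Rightarrow> 'a set" where
  "measure_support H = {u. \<forall>U. open U \<and> u \<in> U \<longrightarrow> emeasure H U > 0}"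

definition mixture :: "real \<Rightarrow> 'a measure \<Rightarrow> 'a measure \<Rightarrow> 'a measure" where
  "mixture \<epsilon> P H = measure_of (space P) (sets P)
     (\<lambda>A. ennreal (1 - \<epsilon>) * emeasure P A + ennreal \<epsilon> * emeasure H A)"

lemma space_mixture [simp]: "space (mixture \<epsilon> P H) = space P"
  by (simp add: mixture_def sets.space_closed space_measure_of)

lemma sets_mixture [simp]: "sets (mixture \<epsilon> P H) = sets P"
  by (simp add: mixture_def)

lemma emeasure_mixture:
  assumes "sets H = sets P" "A \<in> sets P"
  shows "emeasure (mixture \<epsilon> P H) A
    = ennreal (1 - \<epsilon>) * emeasure P A + ennreal \<epsilon> * emeasure H A"
proof (rule emeasure_measure_of[OF mixture_def])
  show "countably_additive (sets (mixture \<epsilon> P H))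
      (\<lambda>A. ennreal (1 - \<epsilon>) * emeasure P A + ennreal \<epsilon> * emeasure H A)"
    using assms(1)
    by (auto simp: countably_additive_def suminf_add[symmetric] suminf_emeasure)
qed (use assms in \<open>auto simp: positive_def dest: sets.sets_into_space\<close>)

text \<open>The logarithm with \<open>log 0 = -\<infinity>\<close> (the library has \<open>ln 0 = 0\<close>), and the integral of an
  extended real function, which is meaningful if \<open>integral_exists\<close>.\<close>

definition ext_ln :: "ennreal \<Rightarrow> ereal" where
  "ext_ln t = (if t = 0 then -\<infinity> else if t = \<infinity> then \<infinity> else ereal (ln (enn2real t)))"

definition integral_exists :: "'a measure \<Rightarrow> ('a \<Rightarrow> ereal) \<Rightarrow> bool" where
  "integral_exists N f \<longleftrightarrow>
     (\<integral>\<^sup>+u. e2ennreal (f u) \<partial>N) < \<infinity> \<or> (\<integral>\<^sup>+u. e2ennreal (- f u) \<partial>N) < \<infinity>"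

definition ext_integral :: "'a measure \<Rightarrow> ('a \<Rightarrow> ereal) \<Rightarrow> ereal" where
  "ext_integral N f =
     enn2ereal (\<integral>\<^sup>+u. e2ennreal (f u) \<partial>N) - enn2ereal (\<integral>\<^sup>+u. e2ennreal (- f u) \<partial>N)"

definition dominated_submodel :: "'a measure set \<Rightarrow> 'a measure \<Rightarrow> 'a measure set" where
  "dominated_submodel \<M> P = {P1\<in>\<M>. absolutely_continuous P P1}"

definition log_density :: "'a measure \<Rightarrow> 'a measure \<Rightarrow> 'a \<Rightarrow> ereal" where
  "log_density \<nu> P1 u = ext_ln (RN_deriv \<nu> P1 u)"

text \<open>\<open>R\<close> is a maximiser of \<open>\<integral> log (dP1/d\<nu>) dN\<close> over the \<open>P1\<close> in \<open>\<M>\<close> with \<open>P1 \<lless> P\<close>.\<close>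

definition is_KL_projection ::
    "'a measure set \<Rightarrow> 'a measure \<Rightarrow> 'a measure \<Rightarrow> 'a measure \<Rightarrow> 'a measure \<Rightarrow> bool" where
  "is_KL_projection \<M> P \<nu> N R \<longleftrightarrow>
     (\<forall>P1\<in>dominated_submodel \<M> P. integral_exists N (log_density \<nu> P1)) \<and>
     is_arg_max (\<lambda>P1. ext_integral N (log_density \<nu> P1))
       (\<lambda>P1. P1 \<in> dominated_submodel \<M> P) R"

section \<open>Iterated limits\<close>

definition iterated_null :: "(real \<Rightarrow> real \<Rightarrow> ennreal) \<Rightarrow> bool" where
  "iterated_null f \<longleftrightarrow>
     ((\<lambda>lam. Limsup (at_right 0) (\<lambda>\<epsilon>. f \<epsilon> lam)) \<longlongrightarrow> 0) (at_right 0)"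

definition iterated_limit :: "(real \<Rightarrow> real \<Rightarrow> real) \<Rightarrow> real \<Rightarrow> bool" where
  "iterated_limit f L \<longleftrightarrow> iterated_null (\<lambda>\<epsilon> lam. ennreal \<bar>f \<epsilon> lam - L\<bar>)"

end

theory Submission
  imports Defs
begin

text \<open>The mean of \<open>\<phi>\<^sup>* = \<phi> (Pstar \<epsilon> lam)\<close> under \<open>H - P\<close> differs from \<open>\<phi> P x\<close> by three errors:
  \<open>\<integral> \<phi>\<^sup>* dH - \<integral> \<phi>\<^sub>P dH\<close>, the smoothing error \<open>\<integral> \<phi>\<^sub>P dH - \<phi>\<^sub>P x\<close> and the bias \<open>\<integral> \<phi>\<^sup>* dP\<close>.
  The last two vanish by assumption, and the first is at most \<open>\<integral> \<bar>\<phi>\<^sup>* - \<phi>\<^sub>P\<bar> dH\<close>. Two estimates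
  of this integral give the two sufficient conditions. A Borel measure on a second countable space
  is carried by its support, so the integral is at most the supremum over the support times the
  total mass (\<open>nn_integral_le_sup_norm\<close>). Alternatively, moving to \<open>P\<close> through the density
  \<open>dH/dP\<close>, the Cauchy--Schwarz inequality bounds it by the product of the two
  \<open>L\<^sub>2(P)\<close> norms (\<open>nn_integral_le_density_L2_norm\<close>).\<close>

section \<open>Iterated limits\<close>

text \<open>The arbitrarily-close reading of an iterated limit: it turns the calculus of iterated limits
  into statements about what holds eventually, with no limit superior in them.\<close>

lemma iterated_null_iff:
  "iterated_null f \<longleftrightarrow> (\<forall>e>0. \<forall>\<^sub>F lam in at_right 0. \<forall>\<^sub>F \<epsilon> in at_right 0. f \<epsilon> lam < e)"
proof
  assume "iterated_null f"
  then show "\<forall>e>0. \<forall>\<^sub>F lam in at_right 0. \<forall>\<^sub>F \<epsilon> in at_right 0. f \<epsilon> lam < e"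
    unfolding iterated_null_def
    by (auto dest!: order_tendstoD(2) elim!: eventually_mono intro: Limsup_lessD)
next
  assume small: "\<forall>e>0. \<forall>\<^sub>F lam in at_right 0. \<forall>\<^sub>F \<epsilon> in at_right 0. f \<epsilon> lam < e"
  show "iterated_null f"
    unfolding iterated_null_def
  proof (rule order_tendstoI)
    fix e :: ennreal assume "0 < e"
    then obtain d where d: "0 < d" "d < e" using dense by blast
    have "\<forall>\<^sub>F lam in at_right 0. \<forall>\<^sub>F \<epsilon> in at_right 0. f \<epsilon> lam < d" using small d by blast
    then show "\<forall>\<^sub>F lam in at_right 0. Limsup (at_right 0) (\<lambda>\<epsilon>. f \<epsilon> lam) < e"
    proof eventually_elim
      case (elim lam)
      then have "Limsup (at_right 0) (\<lambda>\<epsilon>. f \<epsilon> lam) \<le> d"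
        by (intro Limsup_bounded) (auto elim: eventually_mono)
      with d show ?case by simp
    qed
  qed simp
qed

lemma iterated_null_add:
  assumes "iterated_null f" "iterated_null g"
  shows "iterated_null (\<lambda>\<epsilon> lam. f \<epsilon> lam + g \<epsilon> lam)"
  unfolding iterated_null_iff
proof (intro allI impI)
  fix e :: ennreal assume "0 < e"
  then have e2: "0 < e / 2"
    by (simp add: ennreal_zero_less_divide)
  then have "\<forall>\<^sub>F lam in at_right 0. \<forall>\<^sub>F \<epsilon> in at_right 0. f \<epsilon> lam < e / 2"
    and "\<forall>\<^sub>F lam in at_right 0. \<forall>\<^sub>F \<epsilon> in at_right 0. g \<epsilon> lam < e / 2"
    using assms unfolding iterated_null_iff by blast+
  then show "\<forall>\<^sub>F lam in at_right 0. \<forall>\<^sub>F \<epsilon> in at_right 0. f \<epsilon> lam + g \<epsilon> lam < e"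
  proof eventually_elim
    case (elim lam)
    from elim(1,2) show ?case
    proof eventually_elim
      case (elim \<epsilon>)
      then have "f \<epsilon> lam + g \<epsilon> lam < e / 2 + e / 2" by (rule add_strict_mono)
      also have "e / 2 + e / 2 = e * 2 / 2"
        by (simp only: mult_2_right add_divide_distrib_ennreal)
      also have "e * 2 / 2 = e" by (rule mult_divide_eq_ennreal) simp_all
      finally show ?case .
    qed
  qed
qed

lemma iterated_null_mono:
  assumes "iterated_null g"
    and "\<forall>\<^sub>F lam in at_right 0. \<forall>\<^sub>F \<epsilon> in at_right 0. f \<epsilon> lam \<le> g \<epsilon> lam"
  shows "iterated_null f"
  unfolding iterated_null_iff
proof (intro allI impI)
  fix e :: ennreal assume "0 < e"
  then have "\<forall>\<^sub>F lam in at_right 0. \<forall>\<^sub>F \<epsilon> in at_right 0. g \<epsilon> lam < e"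
    using assms(1) unfolding iterated_null_iff by blast
  with assms(2) show "\<forall>\<^sub>F lam in at_right 0. \<forall>\<^sub>F \<epsilon> in at_right 0. f \<epsilon> lam < e"
    by eventually_elim (auto elim: eventually_elim2)
qed

lemma iterated_null_const:
  assumes "(f \<longlongrightarrow> 0) (at_right 0)"
  shows "iterated_null (\<lambda>\<epsilon>. f)"
  using assms unfolding iterated_null_def by (simp add: Limsup_const)

section \<open>The supremum over the support\<close>

text \<open>The complement of the support is the union of the null open sets. By the Lindelof property
  countably many of them already cover it, so it is itself a null set.\<close>

lemma AE_in_measure_support:
  fixes M :: "'a::second_countable_topology measure"
  assumes sets: "sets M = sets borel"
  shows "AE u in M. u \<in> measure_support M"
proof -
  let ?\<F> = "{U. open U \<and> emeasure M U = 0}"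
  obtain \<F> where \<F>: "\<F> \<subseteq> ?\<F>" "countable \<F>" "\<Union>\<F> = \<Union>?\<F>"
    using Lindelof[of ?\<F>] by blast
  have "\<Union>\<F> \<in> null_sets M"
  proof (rule null_sets_UN'[where N = id, simplified])
    show "countable \<F>" by (fact \<F>(2))
    show "U \<in> null_sets M" if "U \<in> \<F>" for U
      using that \<F>(1) sets by (auto simp: null_sets_def)
  qed
  moreover have "{u \<in> space M. u \<notin> measure_support M} \<subseteq> \<Union>\<F>"
    by (auto simp: \<F>(3) measure_support_def)
  ultimately show ?thesis by (rule AE_I')
qed

lemma nn_integral_le_sup_norm:
  fixes M :: "'a::second_countable_topology measure"
  assumes "prob_space M" "sets M = sets borel"
  shows "(\<integral>\<^sup>+u. ennreal \<bar>h u\<bar> \<partial>M) \<le> sup_norm (measure_support M) h"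
proof -
  interpret prob_space M by fact
  have "(\<integral>\<^sup>+u. ennreal \<bar>h u\<bar> \<partial>M) \<le> (\<integral>\<^sup>+u. sup_norm (measure_support M) h \<partial>M)"
    using AE_in_measure_support[OF assms(2)]
    by (intro nn_integral_mono_AE) (auto simp: sup_norm_def intro: SUP_upper elim!: eventually_mono)
  then show ?thesis by (simp add: emeasure_space_1)
qed

section \<open>The Cauchy--Schwarz bound through the density\<close>

lemma ennreal_power2_le_imp_le:
  fixes a b :: ennreal
  assumes "a\<^sup>2 \<le> b\<^sup>2"
  shows "a \<le> b"
  using assms
  by (cases a; cases b)
    (auto simp: ennreal_power power_top_ennreal neq_top_trans top_unique dest: power2_le_imp_le)

lemma L2_norm_power2: "(L2_norm M h)\<^sup>2 = (\<integral>\<^sup>+u. ennreal ((h u)\<^sup>2) \<partial>M)"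
proof (cases "(\<integral>\<^sup>+u. ennreal ((h u)\<^sup>2) \<partial>M) = \<infinity>")
  case True
  then show ?thesis by (simp add: L2_norm_def power2_eq_square ennreal_top_mult)
next
  case False
  then show ?thesis
    by (simp add: L2_norm_def ennreal_power less_top[symmetric] ennreal_enn2real_if)
qed

text \<open>Working with squares keeps the degenerate products sound: when one norm is \<open>0\<close> and the other
  \<open>\<infinity>\<close>, the right-hand side is \<open>0\<close>, and the Cauchy--Schwarz inequality for extended nonnegative
  integrals holds in that case too.\<close>

lemma nn_integral_le_density_L2_norm:
  assumes "sigma_finite_measure M" "sigma_finite_measure N"
    and ac: "absolutely_continuous M N" and sets: "sets N = sets M"
    and [measurable]: "h \<in> borel_measurable M"
  shows "(\<integral>\<^sup>+u. ennreal \<bar>h u\<bar> \<partial>N) \<le> L2_norm M (real_density M N) * L2_norm M h"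
proof -
  interpret sigma_finite_measure M by fact
  have [measurable]: "real_density M N \<in> borel_measurable M"
    unfolding real_density_def by measurable
  have "AE u in M. ennreal (real_density M N u) = RN_deriv M N u"
    using RN_deriv_finite[OF assms(2) ac sets]
    by eventually_elim (simp add: real_density_def less_top)
  then have "(\<integral>\<^sup>+u. RN_deriv M N u * ennreal \<bar>h u\<bar> \<partial>M)
      = (\<integral>\<^sup>+u. ennreal (real_density M N u) * ennreal \<bar>h u\<bar> \<partial>M)"
    by (intro nn_integral_cong_AE) (auto elim: eventually_mono)
  then have "(\<integral>\<^sup>+u. ennreal \<bar>h u\<bar> \<partial>N)
      = (\<integral>\<^sup>+u. ennreal (real_density M N u) * ennreal \<bar>h u\<bar> \<partial>M)"
    by (subst RN_deriv_nn_integral[OF ac sets]) simp_all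
  then have "(\<integral>\<^sup>+u. ennreal \<bar>h u\<bar> \<partial>N)\<^sup>2
      \<le> (\<integral>\<^sup>+u. (ennreal (real_density M N u))\<^sup>2 \<partial>M) * (\<integral>\<^sup>+u. (ennreal \<bar>h u\<bar>)\<^sup>2 \<partial>M)"
    using Cauchy_Schwarz_nn_integral[of "\<lambda>u. ennreal (real_density M N u)" M "\<lambda>u. ennreal \<bar>h u\<bar>"]
    by simp
  also have "\<dots> = (L2_norm M (real_density M N) * L2_norm M h)\<^sup>2"
    by (simp add: power_mult_distrib L2_norm_power2 ennreal_power real_density_def)
  finally show ?thesis by (rule ennreal_power2_le_imp_le)
qed

section \<open>The limit of the perturbed means\<close>

theorem theorem3:
  fixes \<M> :: "('d::finite) distribution set"
    and \<X> :: "'d distribution \<Rightarrow> (real ^ 'd) set"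
    and \<Psi> :: "'d distribution \<Rightarrow> real"
    and \<phi> :: "'d distribution \<Rightarrow> real ^ 'd \<Rightarrow> real"
    and P :: "'d distribution"
    and \<nu> :: "(real ^ 'd) measure"
    and x :: "real ^ 'd"
    and \<G> :: "(real ^ 'd \<Rightarrow> real) set"
    and H :: "real \<Rightarrow> 'd distribution"
    and Pstar :: "real \<Rightarrow> real \<Rightarrow> 'd distribution"
  assumes model: "statistical_model \<M> \<X>"
    and pathwise: "\<forall>Q\<in>\<M>. pathwise_differentiable \<M> \<Psi> Q"
    and EIF: "\<forall>Q\<in>\<M>. is_EIF \<M> \<Psi> Q (\<phi> Q)"
    and P: "P \<in> \<M>"
    and x: "x \<in> \<X> P"
    and H: "smoothing_family P x \<G> H"
    and \<nu>: "sigma_finite_measure \<nu>" "sets \<nu> = sets borel" "absolutely_continuous \<nu> P"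
    and projection: "\<forall>\<^sub>F (\<epsilon>, lam) in at_right 0 \<times>\<^sub>F at_right 0.
      is_KL_projection \<M> P \<nu> (mixture \<epsilon> P (H lam)) (Pstar \<epsilon> lam)"
    and integrable_H: "\<forall>\<^sub>F lam in at_right 0. integrable (H lam) (\<phi> P)"
    and integrable_star: "\<forall>\<^sub>F lam in at_right 0. \<forall>\<^sub>F \<epsilon> in at_right 0.
      integrable P (\<phi> (Pstar \<epsilon> lam)) \<and> integrable (H lam) (\<phi> (Pstar \<epsilon> lam))"
    and lim_H: "((\<lambda>lam. \<integral>u. \<phi> P u \<partial>(H lam)) \<longlongrightarrow> \<phi> P x) (at_right 0)"
    and lim_P: "iterated_limit (\<lambda>\<epsilon> lam. \<integral>u. \<phi> (Pstar \<epsilon> lam) u \<partial>P) 0"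
    and ab: "iterated_null (\<lambda>\<epsilon> lam.
          sup_norm (measure_support (H lam)) (\<lambda>u. \<phi> (Pstar \<epsilon> lam) u - \<phi> P u))
      \<or> iterated_null (\<lambda>\<epsilon> lam.
          L2_norm P (real_density P (H lam)) * L2_norm P (\<lambda>u. \<phi> (Pstar \<epsilon> lam) u - \<phi> P u))"
  shows "iterated_limit
    (\<lambda>\<epsilon> lam. (\<integral>u. \<phi> (Pstar \<epsilon> lam) u \<partial>(H lam)) - (\<integral>u. \<phi> (Pstar \<epsilon> lam) u \<partial>P)) (\<phi> P x)"
proof -
  have prob_P: "prob_space P" and sets_P: "sets P = sets borel"
    using model P by (auto simp: statistical_model_def)
  have H_lam: "prob_space (H lam)" "sets (H lam) = sets borel" "absolutely_continuous P (H lam)"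
    if "lam > 0" for lam
    using H that by (auto simp: smoothing_family_def)

  define gap where "gap \<epsilon> lam = (\<integral>\<^sup>+u. ennreal \<bar>\<phi> (Pstar \<epsilon> lam) u - \<phi> P u\<bar> \<partial>(H lam))" for \<epsilon> lam

  \<comment> \<open>Integrability of \<open>\<phi> P\<close> under any one \<open>H lam\<close> makes it Borel, hence measurable for \<open>P\<close>.\<close>
  have meas: "\<forall>\<^sub>F lam in at_right 0. \<forall>\<^sub>F \<epsilon> in at_right 0.
      (\<lambda>u. \<phi> (Pstar \<epsilon> lam) u - \<phi> P u) \<in> borel_measurable P"
    using integrable_H integrable_star eventually_at_right_less[of 0]
  proof eventually_elim
    case (elim lam)
    have sets_eq: "sets (H lam) = sets P" using H_lam(2)[OF elim(3)] sets_P by simp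
    have "\<phi> P \<in> borel_measurable P"
      using borel_measurable_integrable[OF elim(1)] sets_eq by (simp cong: measurable_cong_sets)
    then show ?case
      using elim(2) by (auto elim!: eventually_mono)
  qed

  have "iterated_null gap"
    using ab
  proof
    assume "iterated_null (\<lambda>\<epsilon> lam.
        sup_norm (measure_support (H lam)) (\<lambda>u. \<phi> (Pstar \<epsilon> lam) u - \<phi> P u))"
    then show ?thesis
    proof (rule iterated_null_mono)
      show "\<forall>\<^sub>F lam in at_right 0. \<forall>\<^sub>F \<epsilon> in at_right 0. gap \<epsilon> lam
          \<le> sup_norm (measure_support (H lam)) (\<lambda>u. \<phi> (Pstar \<epsilon> lam) u - \<phi> P u)"
        using eventually_at_right_less[of 0] unfolding gap_def
        by eventually_elim (simp add: nn_integral_le_sup_norm H_lam)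
    qed
  next
    assume "iterated_null (\<lambda>\<epsilon> lam. L2_norm P (real_density P (H lam))
        * L2_norm P (\<lambda>u. \<phi> (Pstar \<epsilon> lam) u - \<phi> P u))"
    then show ?thesis
    proof (rule iterated_null_mono)
      show "\<forall>\<^sub>F lam in at_right 0. \<forall>\<^sub>F \<epsilon> in at_right 0. gap \<epsilon> lam
          \<le> L2_norm P (real_density P (H lam)) * L2_norm P (\<lambda>u. \<phi> (Pstar \<epsilon> lam) u - \<phi> P u)"
        using meas eventually_at_right_less[of 0]
      proof eventually_elim
        case (elim lam)
        from elim(1) show ?case
        proof eventually_elim
          case inner: (elim \<epsilon>)
          show ?case
            unfolding gap_def
            using prob_P H_lam[OF elim(2)] sets_P inner
            by (intro nn_integral_le_density_L2_norm prob_space_imp_sigma_finite) simp_all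
        qed
      qed
    qed
  qed
  moreover have "iterated_null (\<lambda>\<epsilon> lam. ennreal \<bar>(\<integral>u. \<phi> P u \<partial>(H lam)) - \<phi> P x\<bar>)"
  proof (rule iterated_null_const)
    have "((\<lambda>lam. \<bar>(\<integral>u. \<phi> P u \<partial>(H lam)) - \<phi> P x\<bar>) \<longlongrightarrow> 0) (at_right 0)"
      using lim_H by (simp add: LIM_zero_iff tendsto_rabs_zero_iff)
    then show "((\<lambda>lam. ennreal \<bar>(\<integral>u. \<phi> P u \<partial>(H lam)) - \<phi> P x\<bar>) \<longlongrightarrow> 0) (at_right 0)"
      using tendsto_ennrealI by fastforce
  qed
  moreover have "iterated_null (\<lambda>\<epsilon> lam. ennreal \<bar>\<integral>u. \<phi> (Pstar \<epsilon> lam) u \<partial>P\<bar>)"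
    using lim_P by (simp add: iterated_limit_def)
  ultimately have null_sum: "iterated_null (\<lambda>\<epsilon> lam. gap \<epsilon> lam
      + ennreal \<bar>(\<integral>u. \<phi> P u \<partial>(H lam)) - \<phi> P x\<bar> + ennreal \<bar>\<integral>u. \<phi> (Pstar \<epsilon> lam) u \<partial>P\<bar>)"
    by (intro iterated_null_add)

  show ?thesis
    unfolding iterated_limit_def
  proof (rule iterated_null_mono[OF null_sum])
    show "\<forall>\<^sub>F lam in at_right 0. \<forall>\<^sub>F \<epsilon> in at_right 0.
        ennreal \<bar>(\<integral>u. \<phi> (Pstar \<epsilon> lam) u \<partial>(H lam)) - (\<integral>u. \<phi> (Pstar \<epsilon> lam) u \<partial>P) - \<phi> P x\<bar>
        \<le> gap \<epsilon> lam + ennreal \<bar>(\<integral>u. \<phi> P u \<partial>(H lam)) - \<phi> P x\<bar>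
          + ennreal \<bar>\<integral>u. \<phi> (Pstar \<epsilon> lam) u \<partial>P\<bar>"
      using integrable_H integrable_star
    proof eventually_elim
      case (elim lam)
      from elim(2) show ?case
      proof eventually_elim
        case inner: (elim \<epsilon>)
        let ?\<phi> = "\<phi> (Pstar \<epsilon> lam)"
        let ?d = "\<integral>u. ?\<phi> u - \<phi> P u \<partial>(H lam)"
        have int: "integrable (H lam) (\<lambda>u. ?\<phi> u - \<phi> P u)"
          using elim(1) inner by simp
        have "?d = (\<integral>u. ?\<phi> u \<partial>(H lam)) - (\<integral>u. \<phi> P u \<partial>(H lam))"
          using elim(1) inner by simp
        then have "\<bar>(\<integral>u. ?\<phi> u \<partial>(H lam)) - (\<integral>u. ?\<phi> u \<partial>P) - \<phi> P x\<bar>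
            \<le> \<bar>?d\<bar> + \<bar>(\<integral>u. \<phi> P u \<partial>(H lam)) - \<phi> P x\<bar> + \<bar>\<integral>u. ?\<phi> u \<partial>P\<bar>"
          by linarith
        then have "ennreal \<bar>(\<integral>u. ?\<phi> u \<partial>(H lam)) - (\<integral>u. ?\<phi> u \<partial>P) - \<phi> P x\<bar>
            \<le> ennreal \<bar>?d\<bar> + ennreal \<bar>(\<integral>u. \<phi> P u \<partial>(H lam)) - \<phi> P x\<bar>
              + ennreal \<bar>\<integral>u. ?\<phi> u \<partial>P\<bar>"
          by (simp add: ennreal_plus[symmetric] ennreal_leI del: ennreal_plus)
        also have "ennreal \<bar>?d\<bar> \<le> gap \<epsilon> lam"
          using integral_norm_bound_ennreal[OF int] by (simp add: gap_def)
        finally show ?case by (simp add: add_right_mono)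
      qed
    qed
  qed
qed

end
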